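(* Let $n\geq 1$ be an integer, let $h:[0,1]^n\to\mathbb{R}$ be a linear combination of $n$-place lattice polynomials, let $\mathbf{X}$ be a random vector uniformly distributed on $[0,1]^n$, set $Y_h:=h(\mathbf{X})$, and let $F_h(y):=\Pr[Y_h\leq y]$ be the distribution function of $Y_h$. For every permutation $\sigma$ of $\{1,\ldots,n\}$ and every $i\in\{0,\ldots,n\}$, let $h_i^\sigma:=h\big(\mathbf{1}_{\{\sigma(1),\ldots,\sigma(i)\}}\big)$. Then, for every $y\in\mathbb{R}$, $$F_h(y)=1-\frac{1}{n!}\sum_{\sigma\in\mathfrak{S}_n}\Delta\big[(\,\cdot\,-y)^n_+:h_0^{\sigma},\ldots,h_n^{\sigma}\big],$$ where $\mathfrak{S}_n$ is the set of all permutations of $\{1,\ldots,n\}$ and $\Delta[(\,\cdot\,-y)^n_+:a_0,\ldots,a_n]$ is the $n$th divided difference of the function $x\mapsto(x-y)^n_+$ at $a_0,\ldots,a_n$ (repeated arguments allowed).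
   Context: Lattice polynomials: an $n$-place lattice polynomial is a function $p:[0,1]^n\to[0,1]$ given by a well-formed expression in the variables $x_1,\ldots,x_n$ built using only $\wedge=\min$, $\vee=\max$ and parentheses (no constants), e.g. $(x_1\wedge x_2)\vee x_3$. A linear combination of lattice polynomials is a function $h=\sum_{i=1}^m c_i\,p_i$ with $c_i\in\mathbb{R}$ and $p_i$ $n$-place lattice polynomials. On each simplex $S_\sigma:=\{\mathbf{x}\in[0,1]^n: x_{\sigma(1)}\geq\cdots\geq x_{\sigma(n)}\}$ such an $h$ is given by $h(\mathbf{x})=\sum_{i=1}^n(h_i^\sigma-h_{i-1}^\sigma)\,x_{\sigma(i)}$; in particular $h_0^\sigma=h(\mathbf{0})=0$. For $A\subseteq\{1,\ldots,n\}$, $\mathbf{1}_A\in\{0,1\}^n$ is the characteristic vector of $A$. Truncated power: for an integer $k\geq 0$, $x_+^k:=x^k$ if $x>0$ and $x_+^k:=0$ otherwise (so $x_+^0=1$ for $x>0$ and $x_+^0=0$ for $x\leq 0$). Divided differences: $\Delta[g:\cdot]$ is the symmetric function of its arguments defined inductively by $\Delta[g:a_0]:=g(a_0)$ and $$\Delta[g:a_0,\ldots,a_n]:=\begin{cases}\dfrac{\Delta[g:a_1,\ldots,a_n]-\Delta[g:a_0,\ldots,a_{n-1}]}{a_n-a_0},&a_0\neq a_n,\\[2mm] \dfrac{\partial}{\partial a_0}\Delta[g:a_0,\ldots,a_{n-1}],&a_0=a_n,\end{cases}$$ where in the second case only the first argument $a_0$ is varied. In particular, if all $n+1$ arguments equal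 $a$, then $\Delta[g:a,\ldots,a]=g^{(n)}(a)/n!$. Convention for the degenerate case: the $n$th derivative of $x\mapsto(x-y)_+^n$ is read as $n!\,(x-y)_+^0$ for all $x$, including $x=y$. Thus, if all $n+1$ arguments equal $a$, then $\Delta[(\,\cdot\,-y)_+^n:a,\ldots,a]=(a-y)_+^0$. (This convention matters only when $y=0$ and $h_0^\sigma=\cdots=h_n^\sigma=0$ for some $\sigma$.) *)

theory Defs
  imports "HOL-Probability.Probability" "HOL-Combinatorics.Permutations"
begin

text \<open>Vectors in \<open>[0,1]^n\<close> are functions on \<open>{1..n}\<close>, extensional as required by
  \<^const>\<open>PiM\<close>. Functions on the cube are total functions of which only the values on
  \<open>unit_cube n\<close> matter.\<close>

definition unit_cube :: "nat \<Rightarrow> (nat \<Rightarrow> real) set" where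
  "unit_cube n = (\<Pi>\<^sub>E i\<in>{1..n}. {0..1})"

definition char_vec :: "nat \<Rightarrow> nat set \<Rightarrow> nat \<Rightarrow> real" where
  "char_vec n A = (\<lambda>i\<in>{1..n}. indicator A i)"

datatype lattice_expr =
    Var nat
  | Meet lattice_expr lattice_expr
  | Join lattice_expr lattice_expr

primrec expr_vars :: "lattice_expr \<Rightarrow> nat set" where
  "expr_vars (Var i) = {i}"
| "expr_vars (Meet s t) = expr_vars s \<union> expr_vars t"
| "expr_vars (Join s t) = expr_vars s \<union> expr_vars t"

primrec expr_val :: "lattice_expr \<Rightarrow> (nat \<Rightarrow> real) \<Rightarrow> real" where
  "expr_val (Var i) x = x i"
| "expr_val (Meet s t) x = min (expr_val s x) (expr_val t x)"
| "expr_val (Join s t) x = max (expr_val s x) (expr_val t x)"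

definition lattice_polynomial :: "nat \<Rightarrow> ((nat \<Rightarrow> real) \<Rightarrow> real) \<Rightarrow> bool" where
  "lattice_polynomial n p \<longleftrightarrow>
    (\<exists>t. expr_vars t \<subseteq> {1..n} \<and> (\<forall>x\<in>unit_cube n. p x = expr_val t x))"

definition lattice_combination :: "nat \<Rightarrow> ((nat \<Rightarrow> real) \<Rightarrow> real) \<Rightarrow> bool" where
  "lattice_combination n h \<longleftrightarrow>
    (\<exists>(m::nat) (c :: nat \<Rightarrow> real) p.
       (\<forall>i\<in>{1..m}. lattice_polynomial n (p i)) \<and>
       (\<forall>x\<in>unit_cube n. h x = (\<Sum>i=1..m. c i * p i x)))"

definition truncated_power :: "nat \<Rightarrow> real \<Rightarrow> real" where
  "truncated_power k x = (if x > 0 then x ^ k else 0)"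

text \<open>\<open>divided_difference g n a\<close> is the \<open>n\<close>th divided difference of \<open>g\<close> at
  \<open>a 0, \<dots>, a n\<close>. For coinciding end nodes it is the partial derivative of the
  difference at \<open>a 0, \<dots>, a (n - 1)\<close> in its first node only. It is unspecified where
  that derivative does not exist.\<close>

primrec divided_difference :: "(real \<Rightarrow> real) \<Rightarrow> nat \<Rightarrow> (nat \<Rightarrow> real) \<Rightarrow> real" where
  "divided_difference g 0 a = g (a 0)"
| "divided_difference g (Suc n) a =
    (if a 0 \<noteq> a (Suc n)
     then (divided_difference g n (\<lambda>i. a (Suc i)) - divided_difference g n a)
            / (a (Suc n) - a 0)
     else deriv (\<lambda>x. divided_difference g n (a(0 := x))) (a 0))"

text \<open>The \<open>n\<close>th divided difference of \<open>x \<mapsto> (x - y)\<^sub>+^n\<close> at \<open>a 0, \<dots>, a n\<close>. It fails to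
  exist only if all nodes equal \<open>y\<close>, where the \<open>n\<close>th derivative at the knot would be needed.
  By convention that derivative is \<open>n!\<close> times the truncated power of exponent \<open>0\<close>.\<close>

definition truncated_power_difference :: "nat \<Rightarrow> real \<Rightarrow> (nat \<Rightarrow> real) \<Rightarrow> real" where
  "truncated_power_difference n y a =
    (if \<forall>i\<le>n. a i = y then truncated_power 0 (a 0 - y)
     else divided_difference (\<lambda>x. truncated_power n (x - y)) n a)"

end

theory Submission
  imports Defs
begin

text \<open>The cube is the union of the simplices on which the order of the coordinates is that of
  a permutation. On such a simplex \<open>h\<close> is the combination of the barycentric coordinates with
  coefficients \<open>h\<^sub>0\<^sup>\<sigma>, \<dots>, h\<^sub>n\<^sup>\<sigma>\<close>, so the volume of its part where \<open>h > y\<close> is an integral of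
  \<open>(\<cdot> - y)\<^sub>+^0\<close> over the standard simplex. By the Hermite--Genocchi formula this integral is the
  \<open>n\<close>th divided difference of \<open>(\<cdot> - y)\<^sub>+^n / n!\<close>. The formula itself follows from the fundamental
  theorem of calculus, applied to the segment joining two nodes, and from the symmetry of the
  simplex integral. For two coinciding nodes the derivative that replaces the quotient is a
  limit of quotients, and the simplex integral is continuous in each node.\<close>

subsection \<open>Integrals over simplices\<close>

text \<open>\<open>simplex_integral f b as s c\<close> is the integral of \<open>f\<close>, at \<open>c\<close> plus the combination of the
  nodes with weights \<open>\<lambda>\<close>, over all \<open>\<lambda> \<ge> 0\<close> of sum \<open>s\<close>. The weight of the node \<open>b\<close> is
  determined by the others.\<close>

primrec simplex_integral ::
  "(real \<Rightarrow> ennreal) \<Rightarrow> real \<Rightarrow> real list \<Rightarrow> real \<Rightarrow> real \<Rightarrow> ennreal" where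
  "simplex_integral f b [] s c = f (c + s * b)"
| "simplex_integral f b (a # as) s c =
    (\<integral>\<^sup>+u. (if 0 \<le> u \<and> u \<le> s then simplex_integral f b as (s - u) (c + u * a) else 0) \<partial>lborel)"

text \<open>The recursion changes \<open>s\<close> and \<open>c\<close> together, so the induction
  is on measurability in the pair; the form with \<open>S\<close> and \<open>C\<close> follows by
  composition.\<close>

lemma measurable_simplex_integral [measurable]:
  assumes [measurable]: "f \<in> borel_measurable borel"
    and [measurable]: "S \<in> borel_measurable M" "C \<in> borel_measurable M"
  shows "(\<lambda>w. simplex_integral f b as (S w) (C w)) \<in> borel_measurable M"
proof -
  have "(\<lambda>p. simplex_integral f b as (fst p) (snd p)) \<in> borel_measurable (borel \<Otimes>\<^sub>M borel)"
  proof (induction as)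
    case Nil
    show ?case by simp
  next
    case (Cons a as)
    have [measurable]: "(\<lambda>q. simplex_integral f b as (fst (fst q) - snd q) (snd (fst q) + snd q * a))
        \<in> borel_measurable ((borel \<Otimes>\<^sub>M borel) \<Otimes>\<^sub>M lborel)"
      using measurable_compose[OF _ Cons, of
          "\<lambda>q. (fst (fst q) - snd q, snd (fst q) + snd q * a)" "(borel \<Otimes>\<^sub>M borel) \<Otimes>\<^sub>M lborel"]
      by simp
    show ?case
      unfolding simplex_integral.simps
      by (intro lborel.borel_measurable_nn_integral, subst split_beta') measurable
  qed
  from measurable_compose[OF _ this, of "\<lambda>w. (S w, C w)" M] show ?thesis by simp
qed

section \<open>Symmetry of the simplex integral in its nodes\<close>

lemma nn_integral_reflect:
  fixes g :: "real \<Rightarrow> ennreal"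
  assumes [measurable]: "g \<in> borel_measurable borel"
  shows "(\<integral>\<^sup>+u. g (s - u) \<partial>lborel) = (\<integral>\<^sup>+u. g u \<partial>lborel)"
  using nn_integral_real_affine[OF assms, of "-1" s] by simp

lemma simplex_integral_swap:
  assumes [measurable]: "f \<in> borel_measurable borel"
  shows "simplex_integral f b (p # q # as) s c = simplex_integral f b (q # p # as) s c"
proof -
  \<comment> \<open>The common integrand of both orders of integration, extended by zero from the
    triangle of admissible weights.\<close>
  define D where "D u v = (if 0 \<le> u \<and> 0 \<le> v \<and> u + v \<le> s
    then simplex_integral f b as (s - u - v) (c + u * p + v * q) else 0)" for u v
  have [measurable]: "case_prod D \<in> borel_measurable (lborel \<Otimes>\<^sub>M lborel)"
    unfolding D_def split_beta' by measurable
  have D0: "D u v = 0" "D v u = 0" if "\<not> (0 \<le> u \<and> u \<le> s)" for u v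
    using that by (auto simp: D_def)
  \<comment> \<open>For an outer weight outside \<open>{0..s}\<close> the inner integral vanishes,
    so the guard of the recursion can be reinserted.\<close>
  have D: "(\<integral>\<^sup>+v. D u v \<partial>lborel) = (if 0 \<le> u \<and> u \<le> s then (\<integral>\<^sup>+v. D u v \<partial>lborel) else 0)"
      "(\<integral>\<^sup>+v. D v u \<partial>lborel) = (if 0 \<le> u \<and> u \<le> s then (\<integral>\<^sup>+v. D v u \<partial>lborel) else 0)" for u
    using D0 by auto
  have "simplex_integral f b (p # q # as) s c = (\<integral>\<^sup>+u. \<integral>\<^sup>+v. D u v \<partial>lborel \<partial>lborel)"
    by (subst D) (auto simp: D_def algebra_simps intro!: nn_integral_cong)
  also have "\<dots> = (\<integral>\<^sup>+v. \<integral>\<^sup>+u. D u v \<partial>lborel \<partial>lborel)"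
    by (rule lborel_pair.Fubini') measurable
  also have "\<dots> = simplex_integral f b (q # p # as) s c"
    by (subst D) (auto simp: D_def algebra_simps intro!: nn_integral_cong)
  finally show ?thesis .
qed

text \<open>The earlier nodes only change \<open>s\<close> and \<open>c\<close>. For the last one,
  the reflection of its weight in \<open>{0..s}\<close> exchanges it with the implicit
  weight.\<close>

lemma simplex_integral_swap_last:
  assumes [measurable]: "f \<in> borel_measurable borel"
  shows "simplex_integral f a (as @ [b]) s c = simplex_integral f b (as @ [a]) s c"
proof (induction as arbitrary: s c)
  case Nil
  show ?case
    using nn_integral_reflect[of "\<lambda>u. if 0 \<le> u \<and> u \<le> s then f (c + u * b + (s - u) * a) else 0" s]
    by (simp add: ac_simps cong: if_cong)
qed (simp cong: if_cong)

text \<open>After the exchange of \<open>a\<close> and \<open>b\<close>, adjacent swaps carry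
  \<open>a\<close> to the front. Thus either end of a sequence of nodes can serve as the implicit
  node.\<close>

lemma simplex_integral_rotate:
  assumes [measurable]: "f \<in> borel_measurable borel"
  shows "simplex_integral f a (as @ [b]) s c = simplex_integral f b (a # as) s c"
proof -
  have "simplex_integral f b (as @ [a]) s c = simplex_integral f b (a # as) s c" for s c
  proof (induction as arbitrary: s c)
    case (Cons a' as)
    have "simplex_integral f b ((a' # as) @ [a]) s c = simplex_integral f b (a' # a # as) s c"
      using Cons by (simp cong: if_cong)
    then show ?case
      using simplex_integral_swap[OF assms] by metis
  qed simp
  then show ?thesis
    using simplex_integral_swap_last[OF assms] by metis
qed

section \<open>Bounds and continuity in a node\<close>

lemma simplex_integral_le:
  assumes "mono f" "\<forall>a\<in>set as. a \<le> A" "b \<le> A" "0 \<le> s" "s \<le> 1" "c + s * A \<le> R"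
  shows "simplex_integral f b as s c \<le> f R"
  using assms
proof (induction as arbitrary: s c)
  case Nil
  have "s * b \<le> s * A" using Nil by (intro mult_left_mono) auto
  then show ?case using Nil by (auto intro!: monoD[OF \<open>mono f\<close>])
next
  case (Cons a as)
  have "simplex_integral f b as (s - u) (c + u * a) \<le> f R" if "0 \<le> u" "u \<le> s" for u
  proof (rule Cons.IH)
    have "u * a \<le> u * A" using Cons.prems that by (intro mult_left_mono) auto
    then show "c + u * a + (s - u) * A \<le> R"
      using Cons.prems(6) by (simp add: algebra_simps)
  qed (use Cons.prems that in auto)
  then have "simplex_integral f b (a # as) s c \<le> (\<integral>\<^sup>+u. f R * indicator {0..s} u \<partial>lborel)"
    unfolding simplex_integral.simps by (intro nn_integral_mono) (auto simp: indicator_def)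
  also have "\<dots> = f R * ennreal s"
    using Cons.prems by (simp add: nn_integral_cmult_indicator)
  \<comment> \<open>Since \<open>s \<le> 1\<close>, integration over \<open>{0..s}\<close> does not
    enlarge the bound.\<close>
  also have "\<dots> \<le> f R * 1"
    using Cons.prems by (intro mult_left_mono) auto
  finally show ?case by simp
qed

lemma simplex_integral_finite:
  assumes "mono f" "\<And>x. f x < \<top>" "0 \<le> s" "s \<le> 1"
  shows "simplex_integral f b as s c < \<top>"
proof -
  define A where "A = Max (set (b # as))"
  have "simplex_integral f b as s c \<le> f (c + s * A)"
    using assms by (intro simplex_integral_le[where A = A]) (auto simp: A_def)
  then show ?thesis
    using assms(2) le_less_trans by blast
qed

text \<open>A discontinuity of \<open>f\<close> at the single point \<open>y\<close> is harmless unless all nodes coincide,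
  since otherwise only a null set of the simplex is mapped to \<open>y\<close>.\<close>

lemma tendsto_simplex_integral:
  fixes f :: "real \<Rightarrow> ennreal"
  assumes f: "mono f" "\<And>x. f x < \<top>" "\<And>x. x \<noteq> y \<Longrightarrow> isCont f x"
    and [measurable]: "f \<in> borel_measurable borel"
    and X: "X \<longlonglongrightarrow> b"
    and "0 \<le> s" "s \<le> 1" "(\<exists>a\<in>set as. a \<noteq> b) \<or> isCont f (c + s * b)"
  shows "(\<lambda>i. simplex_integral f (X i) as s c) \<longlonglongrightarrow> simplex_integral f b as s c"
  using assms(6-8)
proof (induction as arbitrary: s c)
  case Nil
  have "(\<lambda>i. c + s * X i) \<longlonglongrightarrow> c + s * b"
    using X by (intro tendsto_intros)
  with Nil show ?case
    by (auto intro: isCont_tendsto_compose)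
next
  case (Cons a as)
  \<comment> \<open>A convergent sequence is bounded, so a single \<open>A\<close> bounds the nodes
    for every \<open>i\<close>, and the constant \<open>f R\<close> on \<open>{0..s}\<close>
    dominates.\<close>
  obtain A0 where A0: "\<And>i. X i \<le> A0"
    using X by (metis convergentI convergent_imp_Bseq Bseq_def abs_le_D1 real_norm_def)
  define A where "A = Max (insert A0 (set (a # as)))"
  have A: "\<And>i. X i \<le> A" "a \<le> A" "\<forall>a\<in>set as. a \<le> A"
    using A0 by (auto simp: A_def intro: max.coboundedI1 max.coboundedI2)
  define R where "R = c + s * A"
  show ?case unfolding simplex_integral.simps
  proof (rule nn_integral_dominated_convergence[where w = "\<lambda>u. f R * indicator {0..s} u"])
    show "AE u in lborel. (if 0 \<le> u \<and> u \<le> s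
        then simplex_integral f (X i) as (s - u) (c + u * a) else 0) \<le> f R * indicator {0..s} u" for i
    proof (intro AE_I2)
      fix u
      have "simplex_integral f (X i) as (s - u) (c + u * a) \<le> f R" if "0 \<le> u" "u \<le> s"
      proof (rule simplex_integral_le[OF f(1) A(3) A(1)])
        have "u * a \<le> u * A" using A that by (intro mult_left_mono) auto
        then show "c + u * a + (s - u) * A \<le> R"
          by (simp add: R_def algebra_simps)
      qed (use Cons.prems that in auto)
      then show "(if 0 \<le> u \<and> u \<le> s
        then simplex_integral f (X i) as (s - u) (c + u * a) else 0) \<le> f R * indicator {0..s} u"
        by auto
    qed
    show "(\<integral>\<^sup>+u. f R * indicator {0..s} u \<partial>lborel) < \<infinity>"
      using f(2)[of R] \<open>0 \<le> s\<close> by (simp add: nn_integral_cmult_indicator ennreal_mult_less_top)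
    \<comment> \<open>For \<open>a \<noteq> b\<close> the excluded \<open>u\<close> is the only one
      that sends the implicit node's argument to \<open>y\<close>. For \<open>a = b\<close> that
      argument is \<open>c + s * b\<close> for every \<open>u\<close>, and the assumption passes to
      the remaining nodes.\<close>
    have conv: "(\<lambda>i. if 0 \<le> u \<and> u \<le> s
          then simplex_integral f (X i) as (s - u) (c + u * a) else 0)
        \<longlonglongrightarrow> (if 0 \<le> u \<and> u \<le> s then simplex_integral f b as (s - u) (c + u * a) else 0)"
      if "u \<noteq> (y - c - s * b) / (a - b)" for u
    proof (cases "0 \<le> u \<and> u \<le> s")
      case True
      have "(\<exists>a\<in>set as. a \<noteq> b) \<or> isCont f (c + u * a + (s - u) * b)"
      proof (cases "a = b")
        case True
        then show ?thesis using Cons.prems(3) by (auto simp: algebra_simps)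
      next
        case False
        then have "c + u * a + (s - u) * b \<noteq> y"
          using that by (auto simp: field_simps)
        then show ?thesis using f(3) by blast
      qed
      with Cons.IH[of "s - u" "c + u * a"] True Cons.prems show ?thesis by auto
    qed auto
    show "AE u in lborel. (\<lambda>i. if 0 \<le> u \<and> u \<le> s
          then simplex_integral f (X i) as (s - u) (c + u * a) else 0)
        \<longlonglongrightarrow> (if 0 \<le> u \<and> u \<le> s then simplex_integral f b as (s - u) (c + u * a) else 0)"
      using AE_lborel_singleton[of "(y - c - s * b) / (a - b)"] by eventually_elim (rule conv)
  qed measurable
qed

subsection \<open>The Hermite--Genocchi formula for truncated powers\<close>

text \<open>With the factorial divided out, differentiation lowers the exponent by one without
  producing a constant.\<close>

definition normalized_power :: "nat \<Rightarrow> real \<Rightarrow> real \<Rightarrow> real" where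
  "normalized_power m y x = truncated_power m (x - y) / fact m"

lemma normalized_power_nonneg [simp]: "0 \<le> normalized_power m y x"
  by (simp add: normalized_power_def truncated_power_def)

lemma mono_normalized_power: "mono (normalized_power m y)"
  by (auto intro!: monoI divide_right_mono power_mono simp: normalized_power_def truncated_power_def)

lemma measurable_normalized_power [measurable]: "normalized_power m y \<in> borel_measurable borel"
  by (intro borel_measurable_mono mono_normalized_power)

lemma normalized_power_Suc: "normalized_power (Suc m) y x = max 0 (x - y) ^ Suc m / fact (Suc m)"
  by (auto simp: normalized_power_def truncated_power_def max_def)

lemma continuous_normalized_power_Suc: "continuous_on UNIV (normalized_power (Suc m) y)"
proof -
  have "normalized_power (Suc m) y = (\<lambda>x. max 0 (x - y) ^ Suc m / fact (Suc m))"
    by (auto simp: normalized_power_Suc)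
  then show ?thesis by (auto intro!: continuous_intros)
qed

text \<open>On either side of the knot the function is a polynomial. At the knot itself it has a
  corner when \<open>m = 0\<close>.\<close>

lemma DERIV_normalized_power:
  assumes "x \<noteq> y"
  shows "(normalized_power (Suc m) y has_real_derivative normalized_power m y x) (at x)"
proof (cases "x > y")
  case True
  have "((\<lambda>x. (x - y) ^ Suc m / fact (Suc m)) has_real_derivative normalized_power m y x) (at x)"
    using True by (auto intro!: derivative_eq_intros
      simp: normalized_power_def truncated_power_def divide_simps simp del: power_Suc fact_Suc)
      (simp add: algebra_simps)
  then show ?thesis
    by (rule has_field_derivative_transform_within_open[where S = "{y<..}"])
      (use True in \<open>auto simp: normalized_power_def truncated_power_def\<close>)
next
  case False
  have "((\<lambda>x. 0) has_real_derivative normalized_power m y x) (at x)"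
    using False by (auto simp: normalized_power_def truncated_power_def)
  then show ?thesis
    by (rule has_field_derivative_transform_within_open[where S = "{..<y}"])
      (use False assms in \<open>auto simp: normalized_power_def truncated_power_def\<close>)
qed

lemma isCont_normalized_power:
  assumes "x \<noteq> y \<or> m > 0"
  shows "isCont (normalized_power m y) x"
proof (cases m)
  case 0
  have "isCont (\<lambda>x. if x \<in> {y<..} then 1 else 0 :: real) x"
    using 0 assms
    by (intro continuous_on_interior[where S = "if x > y then {y<..} else {..<y}"])
      (auto simp: interior_open intro!: continuous_on_cong[THEN iffD2, OF refl _ continuous_on_const])
  then show ?thesis
    using 0 by (simp add: normalized_power_def[abs_def] truncated_power_def cong: if_cong)
next
  case (Suc k)
  then show ?thesis
    using continuous_normalized_power_Suc continuous_on_eq_continuous_at by blast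
qed

abbreviation spline_integral :: "nat \<Rightarrow> real \<Rightarrow> real \<Rightarrow> real list \<Rightarrow> real \<Rightarrow> real \<Rightarrow> ennreal" where
  "spline_integral m y \<equiv> simplex_integral (\<lambda>x. ennreal (normalized_power m y x))"

lemma mono_ennreal_normalized_power: "mono (\<lambda>x. ennreal (normalized_power m y x))"
  using mono_normalized_power[of m y] by (auto simp: mono_def intro!: ennreal_leI)

text \<open>As weight moves from \<open>a\<close> to \<open>b\<close>, the argument of the power
  moves with speed \<open>b - a\<close>, and the fundamental theorem of calculus evaluates the
  innermost integral. The difference is written as a sum because subtraction in
  \<open>ennreal\<close> truncates.\<close>

lemma spline_integral_recursion:
  assumes "a < b" "0 \<le> s"
  shows "ennreal (b - a) * spline_integral m y a (as @ [b]) s c + spline_integral (Suc m) y a as s c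
    = spline_integral (Suc m) y b as s c"
  using \<open>0 \<le> s\<close>
proof (induction as arbitrary: s c)
  case Nil
  define g where "g u = c + u * b + (s - u) * a" for u
  define F where "F u = normalized_power (Suc m) y (g u)" for u
  define F' where "F' u = (b - a) * normalized_power m y (g u)" for u
  have g[measurable]: "g \<in> borel_measurable borel"
    unfolding g_def by measurable
  have [measurable]: "F' \<in> borel_measurable borel"
    unfolding F'_def by measurable
  have "(F' has_integral (F s - F 0)) {0..s}"
  proof (rule fundamental_theorem_of_calculus_interior_strong)
    \<comment> \<open>The only \<open>u\<close> with \<open>g u = y\<close>; there continuity of
      \<open>F\<close> replaces differentiability.\<close>
    show "finite {(y - c - s * a) / (b - a)}" by simp
    show "(F has_vector_derivative F' u) (at u)"
      if "u \<in> {0<..<s} - {(y - c - s * a) / (b - a)}" for u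
    proof -
      have "g u \<noteq> y"
        using that assms by (auto simp: g_def field_simps)
      then have "(normalized_power (Suc m) y has_real_derivative normalized_power m y (g u)) (at (g u))"
        by (rule DERIV_normalized_power)
      moreover have "(g has_real_derivative (b - a)) (at u)"
        unfolding g_def by (auto intro!: derivative_eq_intros)
      ultimately have "(F has_real_derivative normalized_power m y (g u) * (b - a)) (at u)"
        unfolding F_def by (rule DERIV_chain2)
      then show ?thesis
        by (simp add: F'_def has_real_derivative_iff_has_vector_derivative mult.commute)
    qed
    show "continuous_on {0..s} F"
      unfolding F_def g_def
      by (rule continuous_on_compose2[OF continuous_normalized_power_Suc]) (auto intro!: continuous_intros)
  qed fact
  then have int: "((\<lambda>u. if u \<in> {0..s} then F' u else 0) has_integral (F s - F 0)) UNIV"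
    by (simp only: has_integral_restrict_UNIV)
  have F'_nonneg: "0 \<le> F' u" for u
    using assms by (simp add: F'_def)
  have nonneg: "F 0 \<le> F s"
    using assms Nil by (auto simp: F_def g_def intro!: monoD[OF mono_normalized_power] mult_left_mono)
  have "(\<integral>\<^sup>+u. (if u \<in> {0..s} then F' u else 0) \<partial>lborel) = F s - F 0"
    using F'_nonneg by (intro nn_integral_has_integral_lborel int) (auto intro!: measurable_If)
  moreover have "(\<integral>\<^sup>+u. (if u \<in> {0..s} then F' u else 0) \<partial>lborel)
      = (\<integral>\<^sup>+u. ennreal (b - a) * (if 0 \<le> u \<and> u \<le> s then normalized_power m y (g u) else 0) \<partial>lborel)"
    using assms by (auto simp: F'_def ennreal_mult intro!: nn_integral_cong)
  ultimately have "ennreal (b - a) * spline_integral m y a ([] @ [b]) s c = ennreal (F s - F 0)"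
    by (simp add: nn_integral_cmult g_def algebra_simps if_distrib[of ennreal] cong: if_cong)
  then show ?case
    using nonneg by (simp add: F_def g_def flip: ennreal_plus)
next
  case (Cons a' as)
  let ?I = "\<lambda>f u. if 0 \<le> u \<and> u \<le> s then (f (s - u) (c + u * a') :: ennreal) else 0"
  have "ennreal (b - a) * spline_integral m y a ((a' # as) @ [b]) s c + spline_integral (Suc m) y a (a' # as) s c
    = (\<integral>\<^sup>+u. ennreal (b - a) * ?I (spline_integral m y a (as @ [b])) u
         + ?I (spline_integral (Suc m) y a as) u \<partial>lborel)"
    by (simp add: nn_integral_add nn_integral_cmult)
  also have "\<dots> = spline_integral (Suc m) y b (a' # as) s c"
    unfolding simplex_integral.simps using Cons by (intro nn_integral_cong) auto
  finally show ?case .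
qed

text \<open>The integral over the standard simplex, moved to the reals because divided differences
  need signed differences.\<close>

definition real_spline :: "nat \<Rightarrow> real \<Rightarrow> real \<Rightarrow> real list \<Rightarrow> real" where
  "real_spline m y b as = enn2real (spline_integral m y b as 1 0)"

lemma ennreal_real_spline: "ennreal (real_spline m y b as) = spline_integral m y b as 1 0"
  unfolding real_spline_def
  by (intro ennreal_enn2real simplex_integral_finite mono_ennreal_normalized_power) auto

lemma real_spline_rotate: "real_spline m y a (as @ [b]) = real_spline m y b (a # as)"
  unfolding real_spline_def by (simp add: simplex_integral_rotate)

lemma real_spline_swap_last: "real_spline m y a (as @ [b]) = real_spline m y b (as @ [a])"
  unfolding real_spline_def by (simp add: simplex_integral_swap_last[of _ a])

text \<open>For distinct nodes, division by \<open>b - a\<close> gives exactly the recursion of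
  divided differences.\<close>

lemma real_spline_recursion:
  "(b - a) * real_spline m y a (as @ [b]) = real_spline (Suc m) y b as - real_spline (Suc m) y a as"
proof -
  have *: "(b - a) * real_spline m y a (as @ [b]) = real_spline (Suc m) y b as - real_spline (Suc m) y a as"
    if "a < b" for a b
  proof -
    have nn: "0 \<le> real_spline m y b as" for m b as
      by (simp add: real_spline_def)
    have "ennreal ((b - a) * real_spline m y a (as @ [b]) + real_spline (Suc m) y a as)
        = ennreal (real_spline (Suc m) y b as)"
      using spline_integral_recursion[OF that, of 1 m y as 0] that nn
      by (simp add: ennreal_plus ennreal_mult ennreal_real_spline)
    then show ?thesis
      using that nn by (subst (asm) ennreal_inj) (auto intro!: add_nonneg_nonneg mult_nonneg_nonneg)
  qed
  show ?thesis
  proof (cases a b rule: linorder_cases)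
    \<comment> \<open>Exchanging \<open>a\<close> and \<open>b\<close> leaves the spline on the left
      unchanged and negates both sides.\<close>
    case greater
    from *[OF this] show ?thesis
      unfolding real_spline_swap_last[of m y a as b] by (simp add: algebra_simps)
  qed (use * in auto)
qed

lemma tendsto_real_spline:
  assumes "(\<exists>a\<in>set as. a \<noteq> b) \<or> b \<noteq> y \<or> m > 0"
  shows "((\<lambda>x. real_spline m y x as) \<longlongrightarrow> real_spline m y b as) (at b)"
  unfolding tendsto_at_iff_sequentially comp_def
proof (intro allI impI)
  fix X assume X: "X \<longlonglongrightarrow> b"
  have "(\<lambda>i. spline_integral m y (X i) as 1 0) \<longlonglongrightarrow> spline_integral m y b as 1 0"
    using X assms
    by (intro tendsto_simplex_integral[where y = y] mono_ennreal_normalized_power)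
      (auto simp: isCont_def intro!: tendsto_ennrealI isCont_normalized_power[unfolded isCont_def])
  then have "(\<lambda>i. ennreal (real_spline m y (X i) as)) \<longlonglongrightarrow> ennreal (real_spline m y b as)"
    by (simp add: ennreal_real_spline)
  then show "(\<lambda>i. real_spline m y (X i) as) \<longlonglongrightarrow> real_spline m y b as"
    by (rule tendsto_ennrealD) (auto simp: real_spline_def)
qed

lemma divided_difference_truncated_power:
  assumes "k \<le> n" "\<not> (k = n \<and> (\<forall>i\<le>k. a i = y))"
  shows "divided_difference (\<lambda>x. truncated_power n (x - y)) k a
    = fact n * real_spline (n - k) y (a 0) (map a [1..<Suc k])"
  using assms
proof (induction k arbitrary: a)
  case 0
  then show ?case
    by (simp add: real_spline_def normalized_power_def truncated_power_def)
next
  case (Suc k)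
  define as where "as = map a [1..<Suc k]"
  define m where "m = n - Suc k"
  have IH: "divided_difference (\<lambda>x. truncated_power n (x - y)) k a'
      = fact n * real_spline (Suc m) y (a' 0) (map a' [1..<Suc k])" for a'
    using Suc.IH[of a'] Suc.prems by (simp add: m_def Suc_diff_Suc del: upt_Suc)
  have nodes: "map a [1..<Suc (Suc k)] = as @ [a (Suc k)]"
    by (simp add: as_def)
  show ?case
  proof (cases "a 0 = a (Suc k)")
    case False
    \<comment> \<open>Rotation makes \<open>a (Suc k)\<close> the implicit node instead of
      \<open>a 1\<close>, so that both terms of the numerator have the same listed nodes
      \<open>as\<close>.\<close>
    have "real_spline (Suc m) y (a 1) (map (\<lambda>i. a (Suc i)) [1..<Suc k])
        = real_spline (Suc m) y (a (Suc k)) as"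
    proof (cases "k = 0")
      case False
      define bs where "bs = map (\<lambda>i. a (Suc i)) [1..<k]"
      have "as = a 1 # bs"
        using False by (simp add: as_def bs_def upt_conv_Cons flip: map_Suc_upt del: upt_Suc)
      moreover have "map (\<lambda>i. a (Suc i)) [1..<Suc k] = bs @ [a (Suc k)]"
        using False by (simp add: bs_def)
      ultimately show ?thesis
        by (simp only: real_spline_rotate)
    qed (simp add: as_def)
    then have "divided_difference (\<lambda>x. truncated_power n (x - y)) (Suc k) a
        = fact n * (real_spline (Suc m) y (a (Suc k)) as - real_spline (Suc m) y (a 0) as) / (a (Suc k) - a 0)"
      unfolding as_def using False by (simp add: IH right_diff_distrib del: upt_Suc)
    also have "\<dots> = fact n * real_spline m y (a 0) (as @ [a (Suc k)])"
      using False by (simp flip: real_spline_recursion)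
    finally show ?thesis
      by (simp only: nodes m_def)
  next
    case True
    have upd: "divided_difference (\<lambda>x. truncated_power n (x - y)) k (a(0 := x))
        = fact n * real_spline (Suc m) y x as" for x
      unfolding IH as_def by (auto intro!: arg_cong2[where f = "real_spline _ _"])
    \<comment> \<open>The difference quotient is itself a spline integral, with \<open>x\<close> in
      place of one of the two coinciding nodes. The derivative is then its limit by continuity in
      that node.\<close>
    have quotient: "(fact n * real_spline (Suc m) y x as - fact n * real_spline (Suc m) y (a 0) as) / (x - a 0)
        = fact n * real_spline m y x (as @ [a 0])" if "x \<noteq> a 0" for x
    proof -
      have "fact n * real_spline (Suc m) y x as - fact n * real_spline (Suc m) y (a 0) as
          = (x - a 0) * (fact n * real_spline m y x (as @ [a 0]))"
        using real_spline_recursion[of x "a 0" m y as]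
        unfolding real_spline_swap_last[of m y x as "a 0"]
        by (simp add: mult.left_commute right_diff_distrib)
      then show ?thesis
        using that by simp
    qed
    \<comment> \<open>Continuity could fail only for exponent 0 with all nodes at \<open>y\<close>,
      the case ruled out by assumption.\<close>
    have "(\<exists>a'\<in>set (as @ [a 0]). a' \<noteq> a 0) \<or> a 0 \<noteq> y \<or> m > 0"
    proof (rule ccontr)
      assume *: "\<not> ?thesis"
      then have "Suc k = n" "\<forall>i\<in>{1..<Suc k}. a i = y" "a 0 = y"
        using Suc.prems(1) by (auto simp: as_def m_def)
      with True Suc.prems(2) show False
        by (metis Suc_leI atLeastLessThan_iff le_SucE le_imp_less_Suc not_gr0 One_nat_def)
    qed
    then have "((\<lambda>x. fact n * real_spline m y x (as @ [a 0]))
        \<longlongrightarrow> fact n * real_spline m y (a 0) (as @ [a 0])) (at (a 0))"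
      by (intro tendsto_intros tendsto_real_spline)
    then have "((\<lambda>x. divided_difference (\<lambda>x. truncated_power n (x - y)) k (a(0 := x)))
        has_real_derivative fact n * real_spline m y (a 0) (as @ [a 0])) (at (a 0))"
      unfolding has_field_derivative_iff upd
      by (rule Lim_transform_eventually) (auto simp: eventually_at_filter quotient)
    then show ?thesis
      unfolding nodes using True by (simp add: DERIV_imp_deriv m_def del: upt_Suc)
  qed
qed

section \<open>Constant integrands and coinciding nodes\<close>

lemma simplex_integral_const:
  assumes "0 \<le> s"
  shows "simplex_integral (\<lambda>_. 1) b as s c = ennreal (s ^ length as / fact (length as))"
  using assms
proof (induction as arbitrary: s c)
  case (Cons a as)
  let ?k = "length as"
  let ?F = "\<lambda>u. - ((s - u) ^ Suc ?k / fact (Suc ?k))"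
  have "simplex_integral (\<lambda>_. 1) b (a # as) s c
      = (\<integral>\<^sup>+u. ennreal ((s - u) ^ ?k / fact ?k) * indicator {0..s} u \<partial>lborel)"
    using Cons by (auto intro!: nn_integral_cong)
  also have "\<dots> = ennreal (?F s - ?F 0)"
  proof (rule nn_integral_FTC_Icc)
    show "DERIV ?F u :> (s - u) ^ ?k / fact ?k" for u
      by (auto intro!: derivative_eq_intros simp: divide_simps simp del: power_Suc)
  qed (use Cons in auto)
  finally show ?case by simp
qed simp

lemma simplex_integral_eq_nodes:
  assumes "set as \<subseteq> {b}" "f (c + s * b) = 0"
  shows "simplex_integral f b as s c = 0"
  using assms
proof (induction as arbitrary: s c)
  case (Cons a as)
  then have "simplex_integral f b as (s - u) (c + u * a) = 0" for u
    by (intro Cons.IH) (auto simp: algebra_simps)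
  then show ?case by (simp cong: if_cong)
qed simp

text \<open>When all nodes equal \<open>y\<close>, the convention gives 0, and so does the integral
  because its integrand is constantly the value at the knot. Hence the integral formula has no
  exception.\<close>

lemma truncated_power_difference_eq:
  "truncated_power_difference n y a = fact n * real_spline 0 y (a 0) (map a [1..<Suc n])"
proof (cases "\<forall>i\<le>n. a i = y")
  case True
  then have "spline_integral 0 y (a 0) (map a [1..<Suc n]) 1 0 = 0"
    by (intro simplex_integral_eq_nodes) (auto simp: normalized_power_def truncated_power_def)
  with True show ?thesis
    by (simp add: truncated_power_difference_def truncated_power_def real_spline_def)
next
  case False
  then show ?thesis
    using divided_difference_truncated_power[of n n a y]
    unfolding truncated_power_difference_def if_not_P[OF False] by (simp del: upt_Suc)
qed

subsection \<open>Volumes in the simplices of the cube\<close>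

text \<open>In the coordinates \<open>x\<close> of a chain \<open>s \<ge> x j\<^sub>1 \<ge> \<dots> \<ge> x j\<^sub>n \<ge> 0\<close> the weights of
  \<^const>\<open>simplex_integral\<close> are the successive differences.\<close>

primrec chain_integrand ::
  "(real \<Rightarrow> ennreal) \<Rightarrow> real \<Rightarrow> (nat \<times> real) list \<Rightarrow> real \<Rightarrow> real \<Rightarrow> (nat \<Rightarrow> real) \<Rightarrow> ennreal" where
  "chain_integrand f b [] s c x = f (c + s * b)"
| "chain_integrand f b (p # ps) s c x =
    (if 0 \<le> x (fst p) \<and> x (fst p) \<le> s
     then chain_integrand f b ps (x (fst p)) (c + (s - x (fst p)) * snd p) x else 0)"

lemma chain_integrand_cong:
  "(\<And>j. j \<in> fst ` set ps \<Longrightarrow> x j = x' j) \<Longrightarrow>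
    chain_integrand f b ps s c x = chain_integrand f b ps s c x'"
  by (induction ps arbitrary: s c) auto

lemma sets_PiM_lborel: "sets (\<Pi>\<^sub>M i\<in>J. lborel) = sets (\<Pi>\<^sub>M i\<in>J. borel)"
  by (intro sets_PiM_cong) auto

text \<open>\<open>S\<close> and \<open>C\<close> depend on \<open>x\<close> because the recursion
  replaces them by expressions in the coordinate just read.\<close>

lemma measurable_chain_integrand:
  assumes [measurable]: "f \<in> borel_measurable borel"
    and "fst ` set ps \<subseteq> J"
    and "S \<in> borel_measurable (\<Pi>\<^sub>M i\<in>J. borel)" "C \<in> borel_measurable (\<Pi>\<^sub>M i\<in>J. borel)"
  shows "(\<lambda>x. chain_integrand f b ps (S x) (C x) x) \<in> borel_measurable (\<Pi>\<^sub>M i\<in>J. borel)"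
  using assms(2-4)
proof (induction ps arbitrary: S C)
  case Nil
  note [measurable] = Nil.prems
  show ?case by simp
next
  case (Cons p ps)
  note [measurable] = Cons.prems(2,3)
  define Z :: "(nat \<Rightarrow> real) \<Rightarrow> real" where "Z x = x (fst p)" for x
  have [measurable]: "Z \<in> borel_measurable (\<Pi>\<^sub>M i\<in>J. borel)"
    using measurable_component_singleton[of "fst p" J "\<lambda>_. borel"] Cons.prems(1) by (simp add: Z_def[abs_def])
  have [measurable]: "Measurable.pred (\<Pi>\<^sub>M i\<in>J. borel) (\<lambda>x. Z x \<le> S x)"
    unfolding pred_def using Cons.prems(2) \<open>Z \<in> _\<close> by (intro borel_measurable_le)
  have [measurable]: "(\<lambda>x. chain_integrand f b ps (Z x) (C x + (S x - Z x) * snd p) x)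
      \<in> borel_measurable (\<Pi>\<^sub>M i\<in>J. borel)"
    using Cons.prems by (intro Cons.IH) auto
  show ?case
    unfolding chain_integrand.simps Z_def[symmetric] by measurable
qed

text \<open>The first coordinate of the chain is integrated outermost. The substitution
  \<open>u = s - v\<close> turns it into the weight of its node, which leaves \<open>v\<close> for
  the remaining ones.\<close>

lemma nn_integral_chain_integrand:
  assumes [measurable]: "f \<in> borel_measurable borel" and "distinct (map fst ps)"
  shows "(\<integral>\<^sup>+x. chain_integrand f b ps s c x \<partial>(\<Pi>\<^sub>M i\<in>fst ` set ps. lborel))
    = simplex_integral f b (map snd ps) s c"
  using assms(2)
proof (induction ps arbitrary: s c)
  case Nil
  interpret product_sigma_finite "\<lambda>_::nat. lborel :: real measure" by standard
  show ?case by (simp add: PiM_empty)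
next
  case (Cons p ps)
  interpret product_sigma_finite "\<lambda>_::nat. lborel :: real measure" by standard
  let ?J = "fst ` set ps"
  have p: "fst p \<notin> ?J"
    using Cons.prems by (auto simp: image_iff)
  let ?g = "\<lambda>v. if 0 \<le> v \<and> v \<le> s then simplex_integral f b (map snd ps) v (c + (s - v) * snd p) else 0"
  have "(\<integral>\<^sup>+x. chain_integrand f b (p # ps) s c x \<partial>(\<Pi>\<^sub>M i\<in>fst ` set (p # ps). lborel))
      = (\<integral>\<^sup>+v. \<integral>\<^sup>+x. chain_integrand f b (p # ps) s c (x(fst p := v)) \<partial>(\<Pi>\<^sub>M i\<in>?J. lborel) \<partial>lborel)"
    unfolding list.set image_insert
  proof (rule product_nn_integral_insert_rev)
    show "chain_integrand f b (p # ps) s c \<in> borel_measurable (\<Pi>\<^sub>M i\<in>insert (fst p) ?J. lborel)"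
      unfolding measurable_cong_sets[OF sets_PiM_lborel refl]
      by (rule measurable_chain_integrand) auto
  qed (use p in auto)
  also have "\<dots> = (\<integral>\<^sup>+v. ?g v \<partial>lborel)"
  proof (intro nn_integral_cong)
    fix v
    have "chain_integrand f b ps v c' (x(fst p := v)) = chain_integrand f b ps v c' x" for c' x
      using p by (intro chain_integrand_cong) (metis fun_upd_other)
    then show "(\<integral>\<^sup>+x. chain_integrand f b (p # ps) s c (x(fst p := v)) \<partial>(\<Pi>\<^sub>M i\<in>?J. lborel)) = ?g v"
      using Cons by (cases "0 \<le> v \<and> v \<le> s") auto
  qed
  also have "\<dots> = (\<integral>\<^sup>+u. ?g (s - u) \<partial>lborel)"
    by (rule nn_integral_reflect[symmetric]) measurable
  also have "\<dots> = simplex_integral f b (map snd (p # ps)) s c"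
    by (auto intro!: nn_integral_cong)
  finally show ?case .
qed

section \<open>Lattice combinations on the simplices of the cube\<close>

definition order_simplex :: "nat \<Rightarrow> (nat \<Rightarrow> nat) \<Rightarrow> (nat \<Rightarrow> real) set" where
  "order_simplex n \<sigma> = {x \<in> unit_cube n. \<forall>i\<in>{1..n}. \<forall>j\<in>{i..n}. x (\<sigma> j) \<le> x (\<sigma> i)}"

text \<open>Summation by parts. The node \<open>a (i - 1)\<close> is weighted by the drop down to
  \<open>x (\<sigma> i)\<close>, and the implicit node \<open>a n\<close> by the final drop to 0;
  collecting by coordinates gives the increments of \<open>a\<close>.\<close>

lemma chain_integrand_eq:
  assumes "m \<le> n"
  shows "chain_integrand f (a n) (map (\<lambda>i. (\<sigma> i, a (i - 1))) [Suc m..<Suc n]) s c x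
    = (if \<forall>i\<in>{m<..n}. 0 \<le> x (\<sigma> i) \<and> x (\<sigma> i) \<le> s \<and> (\<forall>j\<in>{i..n}. x (\<sigma> j) \<le> x (\<sigma> i))
       then f (c + s * a m + (\<Sum>i\<in>{m<..n}. x (\<sigma> i) * (a i - a (i - 1)))) else 0)"
  using assms
proof (induction m arbitrary: s c rule: inc_induct)
  case base
  show ?case by simp
next
  case (step m)
  have Ioc: "{m<..n} = insert (Suc m) {Suc m<..n}"
    using step.hyps by auto
  let ?z = "x (\<sigma> (Suc m))"
  have chain: "(\<forall>i\<in>{m<..n}. 0 \<le> x (\<sigma> i) \<and> x (\<sigma> i) \<le> s \<and> (\<forall>j\<in>{i..n}. x (\<sigma> j) \<le> x (\<sigma> i)))
      \<longleftrightarrow> 0 \<le> ?z \<and> ?z \<le> s \<and>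
        (\<forall>i\<in>{Suc m<..n}. 0 \<le> x (\<sigma> i) \<and> x (\<sigma> i) \<le> ?z \<and> (\<forall>j\<in>{i..n}. x (\<sigma> j) \<le> x (\<sigma> i)))"
    (is "?L \<longleftrightarrow> ?R")
  proof
    assume ?R
    then show ?L
      unfolding Ioc by (auto simp: Ball_def dest: order_trans) (metis le_neq_implies_less nle_le Suc_le_lessD)+
  qed (auto simp: Ioc)
  have arg: "c + (s - ?z) * a m + ?z * a (Suc m) + (\<Sum>i\<in>{Suc m<..n}. x (\<sigma> i) * (a i - a (i - 1)))
      = c + s * a m + (\<Sum>i\<in>{m<..n}. x (\<sigma> i) * (a i - a (i - 1)))"
    unfolding Ioc by (simp add: algebra_simps)
  have upt: "[Suc m..<Suc n] = Suc m # [Suc (Suc m)..<Suc n]"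
    using step.hyps by (simp add: upt_conv_Cons del: upt_Suc)
  show ?case
    unfolding chain upt list.map chain_integrand.simps fst_conv snd_conv step.IH
    by (simp only: arg diff_Suc_1) simp
qed

lemma permutes_atLeastAtMost: "\<sigma> permutes {1..n} \<Longrightarrow> i \<in> {1..n} \<Longrightarrow> \<sigma> i \<in> {1..n::nat}"
  by (simp only: permutes_in_image)

text \<open>Coordinates decrease along \<open>\<sigma>\<close>, so a minimum selects the larger
  position and a maximum the smaller, uniformly on the simplex.\<close>

lemma expr_val_order_simplex:
  assumes "\<sigma> permutes {1..n}" "expr_vars t \<subseteq> {1..n}"
  shows "\<exists>j\<in>{1..n}. \<forall>x\<in>order_simplex n \<sigma>. expr_val t x = x (\<sigma> j)"
  using assms(2)
proof (induction t)
  case (Var i)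
  then show ?case
    using permutes_inverses(1)[OF assms(1)] permutes_atLeastAtMost[OF permutes_inv[OF assms(1)]]
    by (intro bexI[of _ "inv \<sigma> i"]) auto
next
  case (Meet s t)
  then obtain j k where "j \<in> {1..n}" "\<forall>x\<in>order_simplex n \<sigma>. expr_val s x = x (\<sigma> j)"
    and "k \<in> {1..n}" "\<forall>x\<in>order_simplex n \<sigma>. expr_val t x = x (\<sigma> k)"
    by auto
  then show ?case
    by (intro bexI[of _ "max j k"]) (auto simp: order_simplex_def min_def max_def antisym)
next
  case (Join s t)
  then obtain j k where "j \<in> {1..n}" "\<forall>x\<in>order_simplex n \<sigma>. expr_val s x = x (\<sigma> j)"
    and "k \<in> {1..n}" "\<forall>x\<in>order_simplex n \<sigma>. expr_val t x = x (\<sigma> k)"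
    by auto
  then show ?case
    by (intro bexI[of _ "min j k"]) (auto simp: order_simplex_def min_def max_def antisym)
qed

lemma char_vec_image:
  assumes "\<sigma> permutes {1..n}" "k \<in> {1..n}" "i \<le> n"
  shows "char_vec n (\<sigma> ` {1..i}) (\<sigma> k) = of_bool (k \<le> i)"
proof -
  have "\<sigma> k \<in> \<sigma> ` {1..i} \<longleftrightarrow> k \<in> {1..i}"
    using permutes_inj[OF assms(1)] by (rule inj_image_mem_iff)
  then show ?thesis
    using permutes_atLeastAtMost[OF assms(1,2)] assms(2) by (simp add: char_vec_def indicator_def)
qed

text \<open>These are the vertices of the simplex, at which formulas valid on the simplex may be
  evaluated.\<close>

lemma char_vec_order_simplex:
  assumes "\<sigma> permutes {1..n}" "i \<le> n"
  shows "char_vec n (\<sigma> ` {1..i}) \<in> order_simplex n \<sigma>"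
  using assms char_vec_image[OF assms(1) _ assms(2)]
  by (auto simp: order_simplex_def unit_cube_def char_vec_def indicator_def)

text \<open>Each lattice polynomial is one coordinate \<open>x (\<sigma> (J l))\<close> here.
  Evaluation at the vertices shows that the increment of \<open>h\<close> at step \<open>i\<close>
  collects precisely the coefficients with \<open>J l = i\<close>.\<close>

lemma lattice_combination_order_simplex:
  assumes \<sigma>: "\<sigma> permutes {1..n}" and h: "lattice_combination n h" and x: "x \<in> order_simplex n \<sigma>"
  shows "h x = h (char_vec n (\<sigma> ` {1..0})) + (\<Sum>i\<in>{0<..n}. x (\<sigma> i) *
    (h (char_vec n (\<sigma> ` {1..i})) - h (char_vec n (\<sigma> ` {1..i - 1}))))"
proof -
  obtain m c p where p: "\<forall>l\<in>{1..m::nat}. lattice_polynomial n (p l)"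
    and h: "\<forall>x\<in>unit_cube n. h x = (\<Sum>l=1..m. c l * p l x)"
    using h unfolding lattice_combination_def by blast
  have cube: "order_simplex n \<sigma> \<subseteq> unit_cube n"
    by (auto simp: order_simplex_def)
  have "\<exists>j. j \<in> {1..n} \<and> (\<forall>x\<in>order_simplex n \<sigma>. p l x = x (\<sigma> j))" if "l \<in> {1..m}" for l
    using p that expr_val_order_simplex[OF \<sigma>] cube
    unfolding lattice_polynomial_def by (metis subsetD)
  then obtain J where J: "J l \<in> {1..n}" "\<forall>x\<in>order_simplex n \<sigma>. p l x = x (\<sigma> (J l))"
    if "l \<in> {1..m}" for l
    by metis
  have hx: "h x = (\<Sum>l=1..m. c l * x (\<sigma> (J l)))" if "x \<in> order_simplex n \<sigma>" for x
    using h cube that J(2) by (auto intro!: sum.cong)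
  have H: "h (char_vec n (\<sigma> ` {1..i})) = (\<Sum>l=1..m. c l * of_bool (J l \<le> i))" if "i \<le> n" for i
    unfolding hx[OF char_vec_order_simplex[OF \<sigma> that]]
    by (intro sum.cong refl arg_cong2[where f = "(*)"] char_vec_image[OF \<sigma> J(1) that])
  have jump: "h (char_vec n (\<sigma> ` {1..i})) - h (char_vec n (\<sigma> ` {1..i - 1}))
      = (\<Sum>l=1..m. c l * of_bool (J l = i))" if "i \<in> {0<..n}" for i
  proof -
    have "h (char_vec n (\<sigma> ` {1..i})) - h (char_vec n (\<sigma> ` {1..i - 1}))
        = (\<Sum>l=1..m. c l * of_bool (J l \<le> i) - c l * of_bool (J l \<le> i - 1))"
      using that by (subst (1 2) H) (auto simp: sum_subtractf)
    also have "\<dots> = (\<Sum>l=1..m. c l * of_bool (J l = i))"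
      using that by (intro sum.cong) auto
    finally show ?thesis .
  qed
  have "(\<Sum>i\<in>{0<..n}. x (\<sigma> i) * (h (char_vec n (\<sigma> ` {1..i})) - h (char_vec n (\<sigma> ` {1..i - 1}))))
      = (\<Sum>i\<in>{0<..n}. \<Sum>l=1..m. x (\<sigma> i) * (c l * of_bool (J l = i)))"
    by (intro sum.cong refl) (simp only: jump sum_distrib_left)
  also have "\<dots> = (\<Sum>l=1..m. \<Sum>i\<in>{0<..n}. x (\<sigma> i) * (c l * of_bool (J l = i)))"
    by (rule sum.swap)
  also have "\<dots> = (\<Sum>l=1..m. c l * x (\<sigma> (J l)))"
  proof (intro sum.cong refl)
    fix l assume "l \<in> {1..m}"
    then have "J l \<in> {0<..n}" using J(1)[of l] by auto
    moreover have "(\<Sum>i\<in>{0<..n}. x (\<sigma> i) * (c l * of_bool (J l = i)))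
        = (\<Sum>i\<in>{0<..n}. if J l = i then c l * x (\<sigma> i) else 0)"
      by (intro sum.cong) auto
    ultimately show "(\<Sum>i\<in>{0<..n}. x (\<sigma> i) * (c l * of_bool (J l = i))) = c l * x (\<sigma> (J l))"
      by simp
  qed
  also have "\<dots> = h x" by (rule hx[OF x, symmetric])
  moreover have "h (char_vec n (\<sigma> ` {1..0})) = 0"
    using J(1) by (subst H) (force intro!: sum.neutral)+
  ultimately show ?thesis by simp
qed

text \<open>Sorting the indices by decreasing coordinate yields the permutation.\<close>

lemma order_simplex_cover:
  assumes "x \<in> unit_cube n"
  shows "\<exists>\<sigma>. \<sigma> permutes {1..n} \<and> x \<in> order_simplex n \<sigma>"
proof -
  define xs where "xs = sort_key (\<lambda>i. - x i) [1..<Suc n]"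
  \<comment> \<open>List positions start at 0, the permuted indices at 1; outside
    \<open>{1..n}\<close> a permutation must be the identity.\<close>
  define \<sigma> where "\<sigma> i = (if i \<in> {1..n} then xs ! (i - 1) else i)" for i
  have xs: "distinct xs" "length xs = n" "set xs = {1..n}"
    by (auto simp: xs_def)
  have "bij_betw (\<lambda>i. i - 1) {1..n} {..<n}"
    by (rule bij_betwI[where g = Suc]) auto
  moreover have "bij_betw (\<lambda>i. xs ! i) {..<n} {1..n}"
    using bij_betw_nth[OF xs(1)] xs(2,3) by simp
  ultimately have "bij_betw ((\<lambda>i. xs ! i) \<circ> (\<lambda>i. i - 1)) {1..n} {1..n}"
    by (rule bij_betw_trans)
  moreover have "bij_betw \<sigma> {1..n} {1..n} \<longleftrightarrow> bij_betw ((\<lambda>i. xs ! i) \<circ> (\<lambda>i. i - 1)) {1..n} {1..n}"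
    by (rule bij_betw_cong) (simp add: \<sigma>_def)
  ultimately have "bij_betw \<sigma> {1..n} {1..n}"
    by simp
  then have "\<sigma> permutes {1..n}"
    by (rule bij_imp_permutes) (unfold \<sigma>_def, rule if_not_P)
  moreover have "sorted (map (\<lambda>i. - x i) xs)"
    by (simp add: xs_def)
  then have "x (\<sigma> j) \<le> x (\<sigma> i)" if "i \<in> {1..n}" "j \<in> {i..n}" for i j
    using sorted_nth_mono[of "map (\<lambda>i. - x i) xs" "i - 1" "j - 1"] that xs(2)
    by (auto simp: \<sigma>_def)
  ultimately show ?thesis
    using assms by (auto simp: order_simplex_def)
qed

section \<open>Measurability and volumes in the cube\<close>

lemma measurable_coordinate:
  "i \<in> J \<Longrightarrow> (\<lambda>x. x i) \<in> borel_measurable (\<Pi>\<^sub>M i\<in>J. lborel :: real measure)"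
  using measurable_component_singleton[of i J "\<lambda>_. lborel :: real measure"] by simp

text \<open>Off the cube \<open>h\<close> is arbitrary and possibly not measurable, so it is
  replaced by the combination of the expressions evaluated everywhere.\<close>

lemma lattice_combination_measurable:
  assumes "lattice_combination n h"
  obtains h' where "h' \<in> borel_measurable (\<Pi>\<^sub>M i\<in>{1..n}. lborel)"
    and "\<And>x. x \<in> unit_cube n \<Longrightarrow> h x = h' x"
proof -
  obtain m c p where p: "\<forall>l\<in>{1..m::nat}. lattice_polynomial n (p l)"
    and h: "\<forall>x\<in>unit_cube n. h x = (\<Sum>l=1..m. c l * p l x)"
    using assms unfolding lattice_combination_def by blast
  have "\<forall>l\<in>{1..m}. \<exists>t. expr_vars t \<subseteq> {1..n} \<and> (\<forall>x\<in>unit_cube n. p l x = expr_val t x)"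
    using p by (simp add: lattice_polynomial_def)
  from bchoice[OF this] obtain t where
    t: "\<And>l. l \<in> {1..m} \<Longrightarrow> expr_vars (t l) \<subseteq> {1..n}"
      "\<And>l x. l \<in> {1..m} \<Longrightarrow> x \<in> unit_cube n \<Longrightarrow> p l x = expr_val (t l) x"
    by blast
  have expr: "expr_val t \<in> borel_measurable (\<Pi>\<^sub>M i\<in>{1..n}. lborel)" if "expr_vars t \<subseteq> {1..n}" for t
    using that
  proof (induction t)
    case (Var i)
    then show ?case
      unfolding expr_val.simps by (intro measurable_coordinate) simp
  next
    case (Meet s t)
    then show ?case
      unfolding expr_val.simps by (intro borel_measurable_min) simp_all
  next
    case (Join s t)
    then show ?case
      unfolding expr_val.simps by (intro borel_measurable_max) simp_all
  qed
  have "(\<lambda>x. \<Sum>l=1..m. c l * expr_val (t l) x) \<in> borel_measurable (\<Pi>\<^sub>M i\<in>{1..n}. lborel)"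
  proof (rule borel_measurable_sum)
    fix l assume "l \<in> {1..m}"
    from expr[OF t(1)[OF this]]
    show "(\<lambda>x. c l * expr_val (t l) x) \<in> borel_measurable (\<Pi>\<^sub>M i\<in>{1..n}. lborel)"
      by (rule borel_measurable_times[OF borel_measurable_const])
  qed
  moreover have "h x = (\<Sum>l=1..m. c l * expr_val (t l) x)" if "x \<in> unit_cube n" for x
    using h that t(2) by simp
  ultimately show thesis
    by (rule that)
qed

lemma unit_cube_sets: "unit_cube n \<in> sets (\<Pi>\<^sub>M i\<in>{1..n}. lborel)"
  unfolding unit_cube_def by (intro sets_PiM_I_finite) auto

lemma emeasure_unit_cube: "emeasure (\<Pi>\<^sub>M i\<in>{1..n}. lborel) (unit_cube n) = 1"
proof -
  interpret product_sigma_finite "\<lambda>_::nat. lborel :: real measure" by standard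
  show ?thesis
    unfolding unit_cube_def by (subst emeasure_PiM) auto
qed

lemma order_simplex_sets:
  assumes "\<sigma> permutes {1..n}"
  shows "order_simplex n \<sigma> \<in> sets (\<Pi>\<^sub>M i\<in>{1..n}. lborel)"
proof -
  let ?L = "\<Pi>\<^sub>M i\<in>{1..n}. lborel :: real measure"
  have "order_simplex n \<sigma> = unit_cube n \<inter>
      {x \<in> space ?L. \<forall>i\<in>{1..n}. \<forall>j\<in>{i..n}. x (\<sigma> j) \<le> x (\<sigma> i)}"
    using sets.sets_into_space[OF unit_cube_sets] by (auto simp: order_simplex_def)
  moreover have "(\<lambda>x. x (\<sigma> i)) \<in> borel_measurable ?L" if "i \<in> {1..n}" for i
    using permutes_atLeastAtMost[OF assms that] by (rule measurable_coordinate)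
  then have "{x \<in> space ?L. \<forall>i\<in>{1..n}. \<forall>j\<in>{i..n}. x (\<sigma> j) \<le> x (\<sigma> i)} \<in> sets ?L"
    by (intro sets.sets_Collect_finite_All borel_measurable_le) auto
  ultimately show ?thesis
    using unit_cube_sets by auto
qed

text \<open>On the simplex \<open>f (h x)\<close> is the chain integrand whose nodes are the values
  of \<open>h\<close> at the vertices, and outside both integrands vanish.\<close>

lemma nn_integral_order_simplex:
  assumes \<sigma>: "\<sigma> permutes {1..n}" and h: "lattice_combination n h" and "n \<ge> 1"
    and [measurable]: "f \<in> borel_measurable borel"
  defines "a \<equiv> (\<lambda>i. h (char_vec n (\<sigma> ` {1..i})))"
  shows "(\<integral>\<^sup>+x. f (h x) * indicator (order_simplex n \<sigma>) x \<partial>(\<Pi>\<^sub>M i\<in>{1..n}. lborel))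
    = simplex_integral f (a 0) (map a [1..<Suc n]) 1 0"
proof -
  define ps where "ps = map (\<lambda>i. (\<sigma> i, a (i - 1))) [Suc 0..<Suc n]"
  have ps: "fst ` set ps = {1..n}"
    using permutes_image[OF \<sigma>]
    by (simp add: ps_def image_image atLeastLessThanSuc_atLeastAtMost del: upt_Suc)
  have "distinct (map fst ps)"
    unfolding ps_def using permutes_inj_on[OF \<sigma>] by (simp add: distinct_map o_def del: upt_Suc)
  have simplex: "x \<in> order_simplex n \<sigma> \<longleftrightarrow>
      (\<forall>i\<in>{0<..n}. 0 \<le> x (\<sigma> i) \<and> x (\<sigma> i) \<le> 1 \<and> (\<forall>j\<in>{i..n}. x (\<sigma> j) \<le> x (\<sigma> i)))"
    if "x \<in> space (\<Pi>\<^sub>M i\<in>{1..n}. lborel :: real measure)" for x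
  proof -
    have "x \<in> unit_cube n \<longleftrightarrow> (\<forall>i\<in>\<sigma> ` {1..n}. 0 \<le> x i \<and> x i \<le> 1)"
      using that unfolding permutes_image[OF \<sigma>] by (auto simp: unit_cube_def space_PiM PiE_iff)
    then show ?thesis
      by (auto simp: order_simplex_def Suc_le_eq Ball_def)
  qed
  have "(\<integral>\<^sup>+x. f (h x) * indicator (order_simplex n \<sigma>) x \<partial>(\<Pi>\<^sub>M i\<in>{1..n}. lborel))
      = (\<integral>\<^sup>+x. chain_integrand f (a n) ps 1 0 x \<partial>(\<Pi>\<^sub>M i\<in>{1..n}. lborel))"
  proof (intro nn_integral_cong)
    fix x assume "x \<in> space (\<Pi>\<^sub>M i\<in>{1..n}. lborel :: real measure)"
    from simplex[OF this]
    show "f (h x) * indicator (order_simplex n \<sigma>) x = chain_integrand f (a n) ps 1 0 x"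
      unfolding ps_def chain_integrand_eq[OF le0]
      using lattice_combination_order_simplex[OF \<sigma> h, of x] by (auto simp: a_def)
  qed
  also have "\<dots> = simplex_integral f (a n) (map snd ps) 1 0"
    unfolding ps[symmetric] by (rule nn_integral_chain_integrand) fact+
  also have "map snd ps = map a [0..<n]"
    unfolding ps_def by (simp add: o_def flip: map_Suc_upt del: upt_Suc)
  also have "\<dots> = a 0 # map a [1..<n]"
    using \<open>n \<ge> 1\<close> by (simp add: upt_conv_Cons)
  \<comment> \<open>The chain leaves \<open>a n\<close> implicit, whereas the divided difference
    formula has \<open>a 0\<close> in that place.\<close>
  also have "simplex_integral f (a n) \<dots> 1 0 = simplex_integral f (a 0) (map a [1..<n] @ [a n]) 1 0"
    by (rule simplex_integral_rotate[symmetric]) measurable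
  also have "map a [1..<n] @ [a n] = map a [1..<Suc n]"
    using \<open>n \<ge> 1\<close> by simp
  finally show ?thesis .
qed

section \<open>The distribution function as a sum over permutations\<close>

theorem theorem4:
  fixes n :: nat
    and h :: "(nat \<Rightarrow> real) \<Rightarrow> real"
    and M :: "'a measure"
    and X :: "'a \<Rightarrow> nat \<Rightarrow> real"
    and y :: real
  assumes "n \<ge> 1"
    and "lattice_combination n h"
    and "prob_space M"
    and "X \<in> M \<rightarrow>\<^sub>M (\<Pi>\<^sub>M i\<in>{1..n}. lborel)"
    and "\<And>\<omega>. \<omega> \<in> space M \<Longrightarrow> X \<omega> \<in> unit_cube n"
    and "distr M (\<Pi>\<^sub>M i\<in>{1..n}. lborel) X
           = uniform_measure (\<Pi>\<^sub>M i\<in>{1..n}. lborel) (unit_cube n)"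
  shows "measure M {\<omega> \<in> space M. h (X \<omega>) \<le> y}
    = 1 - 1 / fact n *
        (\<Sum>\<sigma> | \<sigma> permutes {1..n}.
           truncated_power_difference n y (\<lambda>i. h (char_vec n (\<sigma> ` {1..i}))))"
proof -
  let ?L = "\<Pi>\<^sub>M i\<in>{1..n}. lborel :: real measure"
  let ?S = "{\<sigma>. \<sigma> permutes {1..n}}"
  obtain h' where h': "h' \<in> borel_measurable ?L"
    and h_eq: "\<And>x. x \<in> unit_cube n \<Longrightarrow> h x = h' x"
    using lattice_combination_measurable[OF assms(2)] by blast
  define P where "P = {x \<in> unit_cube n. h' x > y}"
  define N where "N = {x \<in> unit_cube n. h' x \<le> y}"
  define a where "a \<sigma> i = h (char_vec n (\<sigma> ` {1..i}))" for \<sigma> :: "nat \<Rightarrow> nat" and i :: nat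
  define V where "V \<sigma> = real_spline 0 y (a \<sigma> 0) (map (a \<sigma>) [1..<Suc n])" for \<sigma>
  have cube: "unit_cube n \<subseteq> space ?L"
    by (rule sets.sets_into_space[OF unit_cube_sets])
  have "P = unit_cube n \<inter> {x \<in> space ?L. h' x > y}" "N = unit_cube n \<inter> {x \<in> space ?L. h' x \<le> y}"
    using cube by (auto simp: P_def N_def)
  moreover have "{x \<in> space ?L. h' x > y} \<in> sets ?L" "{x \<in> space ?L. h' x \<le> y} \<in> sets ?L"
    by (intro borel_measurable_less borel_measurable_le borel_measurable_const h')+
  ultimately have P_N: "P \<in> sets ?L" "N \<in> sets ?L"
    using unit_cube_sets by (auto intro: sets.Int)
  have fin: "emeasure ?L A < \<infinity>" if "A \<subseteq> unit_cube n" for A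
    using emeasure_mono[OF that, of ?L] emeasure_unit_cube[of n] unit_cube_sets
    by (auto intro: le_less_trans)
  have simplex_cube: "order_simplex n \<sigma> \<subseteq> unit_cube n" for \<sigma>
    by (auto simp: order_simplex_def)
  have vol_P: "measure ?L (P \<inter> order_simplex n \<sigma>) = V \<sigma>"
    and vol: "measure ?L (order_simplex n \<sigma>) = 1 / fact n" if "\<sigma> permutes {1..n}" for \<sigma>
  proof -
    have "emeasure ?L (P \<inter> order_simplex n \<sigma>) = (\<integral>\<^sup>+x. indicator (P \<inter> order_simplex n \<sigma>) x \<partial>?L)"
      by (intro nn_integral_indicator[symmetric] sets.Int P_N order_simplex_sets that)
    \<comment> \<open>\<open>normalized_power 0 y\<close> is the indicator of the open half-line
      above \<open>y\<close>.\<close>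
    also have "\<dots> = (\<integral>\<^sup>+x. ennreal (normalized_power 0 y (h x)) * indicator (order_simplex n \<sigma>) x \<partial>?L)"
      using simplex_cube[of \<sigma>]
      by (intro nn_integral_cong)
        (auto simp: P_def h_eq normalized_power_def truncated_power_def indicator_def)
    also have "\<dots> = ennreal (V \<sigma>)"
      unfolding V_def ennreal_real_spline a_def
      by (rule nn_integral_order_simplex) (use that assms(1,2) in auto)
    finally show "measure ?L (P \<inter> order_simplex n \<sigma>) = V \<sigma>"
      by (simp add: measure_def V_def real_spline_def)
    \<comment> \<open>With a constant integrand the nodes no longer matter, so all simplices have
      the same volume.\<close>
    have "emeasure ?L (order_simplex n \<sigma>) = (\<integral>\<^sup>+x. 1 * indicator (order_simplex n \<sigma>) x \<partial>?L)"
      by (simp only: mult_1 nn_integral_indicator[OF order_simplex_sets[OF that]])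
    also have "\<dots> = ennreal (1 / fact n)"
      using assms(1) by (subst nn_integral_order_simplex[OF that assms(2,1), of "\<lambda>_. 1"])
        (simp_all add: simplex_integral_const)
    finally show "measure ?L (order_simplex n \<sigma>) = 1 / fact n"
      by (simp add: measure_def)
  qed
  have fin_perm: "finite ?S" by (simp add: finite_permutations)
  have card_perm: "card ?S = fact n" by (simp add: card_permutations)
  have cover: "measure ?L A \<le> (\<Sum>\<sigma>\<in>?S. measure ?L (A \<inter> order_simplex n \<sigma>))"
    if "A \<in> sets ?L" "A \<subseteq> unit_cube n" for A
  proof -
    have "A = (\<Union>\<sigma>\<in>?S. A \<inter> order_simplex n \<sigma>)"
      using that(2) order_simplex_cover by blast
    then have "measure ?L A = measure ?L (\<Union>\<sigma>\<in>?S. A \<inter> order_simplex n \<sigma>)"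
      by simp
    also have "\<dots> \<le> (\<Sum>\<sigma>\<in>?S. measure ?L (A \<inter> order_simplex n \<sigma>))"
      using that(1) by (intro measure_UNION_le fin_perm sets.Int order_simplex_sets) auto
    finally show ?thesis .
  qed
  have split: "measure ?L (P \<inter> B) + measure ?L (N \<inter> B) = measure ?L B"
    if "B \<in> sets ?L" "B \<subseteq> unit_cube n" for B
  proof -
    have "B = (P \<inter> B) \<union> (N \<inter> B)" "(P \<inter> B) \<inter> (N \<inter> B) = {}"
      using that(2) by (auto simp: P_def N_def)
    moreover have "emeasure ?L (P \<inter> B) \<noteq> \<infinity>" "emeasure ?L (N \<inter> B) \<noteq> \<infinity>"
      using fin[OF le_infI2[OF that(2)]] by (simp_all add: less_top)
    ultimately show ?thesis
      using measure_Union[of ?L "P \<inter> B" "N \<inter> B"] sets.Int[OF P_N(1) that(1)] sets.Int[OF P_N(2) that(1)]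
      by presburger
  qed
  have PN_cube: "P \<subseteq> unit_cube n" "N \<subseteq> unit_cube n"
    by (auto simp: P_def N_def)
  have total: "measure ?L P + measure ?L N = 1"
    using split[OF unit_cube_sets] emeasure_unit_cube[of n]
    by (simp add: measure_def Int_absorb2 PN_cube)
  \<comment> \<open>The simplices overlap, but their volumes add up to that of the cube, so both
     covering inequalities are equalities.\<close>
  have "(\<Sum>\<sigma>\<in>?S. measure ?L (P \<inter> order_simplex n \<sigma>)) + (\<Sum>\<sigma>\<in>?S. measure ?L (N \<inter> order_simplex n \<sigma>))
      = (\<Sum>\<sigma>\<in>?S. measure ?L (order_simplex n \<sigma>))"
    unfolding sum.distrib[symmetric] using simplex_cube by (intro sum.cong refl split order_simplex_sets) auto
  also have "\<dots> = (\<Sum>\<sigma>\<in>?S. 1 / fact n)"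
    by (intro sum.cong refl vol) simp
  also have "\<dots> = 1"
    by (simp add: card_perm del: One_nat_def)
  finally have "measure ?L P = (\<Sum>\<sigma>\<in>?S. measure ?L (P \<inter> order_simplex n \<sigma>))"
    using total cover[OF P_N(1) PN_cube(1)] cover[OF P_N(2) PN_cube(2)] by linarith
  also have "\<dots> = (\<Sum>\<sigma>\<in>?S. V \<sigma>)"
    by (intro sum.cong refl vol_P) simp
  finally have P: "measure ?L P = (\<Sum>\<sigma>\<in>?S. V \<sigma>)" .
  have "{\<omega> \<in> space M. h (X \<omega>) \<le> y} = X -` N \<inter> space M"
    using assms(5) by (auto simp: N_def h_eq)
  then have "measure M {\<omega> \<in> space M. h (X \<omega>) \<le> y} = measure (distr M ?L X) N"
    using assms(4) P_N(2) by (simp only: measure_distr)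
  \<comment> \<open>The cube has volume 1, so the uniform measure needs no rescaling.\<close>
  also have "\<dots> = measure ?L N"
    unfolding assms(6) using emeasure_unit_cube[of n]
    by (simp add: measure_def emeasure_uniform_measure[OF unit_cube_sets P_N(2)] Int_absorb1 PN_cube
        divide_ennreal_def del: One_nat_def)
  also have "\<dots> = 1 - (\<Sum>\<sigma>\<in>?S. V \<sigma>)"
    using total P by simp
  also have "(\<Sum>\<sigma>\<in>?S. V \<sigma>) = 1 / fact n * (\<Sum>\<sigma>\<in>?S. truncated_power_difference n y (a \<sigma>))"
    by (simp add: truncated_power_difference_eq V_def sum_distrib_left)
  finally show ?thesis
    by (simp only: a_def[abs_def])
qed

end
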